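(* Let $n\ge 1$ be an integer with $n\neq 2$. In the game of closed $1\times n$ Dots-and-Triangles (as defined in the context), the first player has a winning strategy, i.e. a strategy guaranteeing that she claims strictly more triangles than her opponent, whatever the opponent does.
   Context: The $1\times n$ Dots-and-Triangles board has bottom dots $b_0,b_1,\dots,b_n$ (equally spaced on a line) and top dots $t_1,\dots,t_n$, where $t_i$ lies above the midpoint of $b_{i-1}b_i$, so that the dots form a strip of equilateral triangles. The possible edges are $b_{i-1}b_i$ ($1\le i\le n$), $t_it_{i+1}$ ($1\le i\le n-1$), $t_ib_{i-1}$ and $t_ib_i$ ($1\le i\le n$). The triangles (faces) are $b_{i-1}b_it_i$ ($1\le i\le n$) and $t_it_{i+1}b_i$ ($1\le i\le n-1$), so there are $2n-1$ triangles. In the closed version, the top edges $t_it_{i+1}$ ($1\le i\le n-1$) and the two side edges $b_0t_1$ and $t_nb_n$ are already drawn at the start; all other edges are undrawn. Two players alternate turns; on a move a player draws one currently undrawn edge. If drawing that edge completes one or more triangles (all three sides drawn), the player claims those triangles and must immediately move again (if any undrawn edge remains); otherwise the turn passes to the other player. The game ends when all edges are drawn (equivalently all triangles claimed), and the player who has claimed more triangles wins. *)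

theory Defs
  imports Main
begin

text \<open>Edges of the 1 x n Dots-and-Triangles board:
  Bot i = b_(i-1) b_i (1 <= i <= n), Top i = t_i t_(i+1) (1 <= i <= n-1),
  Lft i = t_i b_(i-1) (1 <= i <= n), Rgt i = t_i b_i (1 <= i <= n).\<close>
datatype edge = Bot nat | Top nat | Lft nat | Rgt nat

definition edges :: "nat \<Rightarrow> edge set" where
  "edges n = {Bot i | i. 1 \<le> i \<and> i \<le> n} \<union> {Top i | i. 1 \<le> i \<and> i < n}
           \<union> {Lft i | i. 1 \<le> i \<and> i \<le> n} \<union> {Rgt i | i. 1 \<le> i \<and> i \<le> n}"

text \<open>Triangles as their sets of three sides: b_(i-1) b_i t_i and t_i t_(i+1) b_i.\<close>
definition triangles :: "nat \<Rightarrow> edge set set" where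
  "triangles n = {{Bot i, Lft i, Rgt i} | i. 1 \<le> i \<and> i \<le> n}
               \<union> {{Top i, Rgt i, Lft (Suc i)} | i. 1 \<le> i \<and> i < n}"

text \<open>Closed version: top edges and the two side edges are drawn initially.\<close>
definition init_drawn :: "nat \<Rightarrow> edge set" where
  "init_drawn n = {Top i | i. 1 \<le> i \<and> i < n} \<union> {Lft 1, Rgt n}"

definition completed :: "nat \<Rightarrow> edge set \<Rightarrow> edge \<Rightarrow> nat" where
  "completed n D e = card {T \<in> triangles n. e \<in> T \<and> T \<subseteq> insert e D}"

text \<open>first_wins n D a b p: in the position where the set of drawn edges is D,
  the first player has claimed a triangles, the second player b triangles, and it is
  the first player's turn iff p, the first player can force that at the end of the
  game she has strictly more triangles than the opponent (winning strategy).\<close>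
inductive first_wins :: "nat \<Rightarrow> edge set \<Rightarrow> nat \<Rightarrow> nat \<Rightarrow> bool \<Rightarrow> bool" for n where
  finished: "edges n - D = {} \<Longrightarrow> a > b \<Longrightarrow> first_wins n D a b p"
| first_move: "e \<in> edges n - D \<Longrightarrow>
     first_wins n (insert e D) (a + completed n D e) b
        (completed n D e > 0) \<Longrightarrow>
     first_wins n D a b True"
| second_move: "edges n - D \<noteq> {} \<Longrightarrow>
     (\<forall>e \<in> edges n - D. first_wins n (insert e D) a (b + completed n D e)
        (completed n D e = 0)) \<Longrightarrow>
     first_wins n D a b False"

end

theory Submission
  imports Defs
begin

text \<open>Number the triangles $0, \ldots, 2m$ along the strip ($m = n - 1$): triangle $k$ has the sides
  $P_k$, $P_{k+1}$, shared with its neighbours, and $Q_k$ on the boundary. The first player plays symmetrically. For even $m$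
  she opens with $Q_m$, for odd $m$ she sacrifices the middle triangle by drawing $P_m$. The main
  claim is that a nonempty symmetric position without a triangle that can be claimed at once, and with
  a suitable centre, is lost for the player to move: drawing a $Q_k$ is answered by its mirror image, opening a chain of
  one or two triangles is answered by taking them and sacrificing the mirrored chain, and opening
  a chain of three or more triangles loses outright, because the opponent may take triangles until two
  are left and then choose whether to take these too or to hand them back together with the move.
  The sacrifice for odd $m$ leaves a nonnegative margin, and the margin is odd because the number
  of triangles is.\<close>

section \<open>Counting the triangles that a move completes\<close>

lemma finite_edges [simp]: "finite (edges n)"
proof -
  have "edges n \<subseteq> Bot ` {..n} \<union> Top ` {..n} \<union> Lft ` {..n} \<union> Rgt ` {..n}"
    unfolding edges_def by auto
  then show ?thesis by (rule finite_subset) auto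
qed

lemma finite_triangles [simp]: "finite (triangles n)"
proof -
  have "triangles n \<subseteq> (\<lambda>i. {Bot i, Lft i, Rgt i}) ` {..n} \<union> (\<lambda>i. {Top i, Rgt i, Lft (Suc i)}) ` {..n}"
    unfolding triangles_def by auto
  then show ?thesis by (rule finite_subset) auto
qed

lemma card_undrawn_insert: "e \<in> edges n - D \<Longrightarrow> card (edges n - insert e D) < card (edges n - D)"
  by (rule psubset_card_mono) auto

lemma completed_mono: "D \<subseteq> D' \<Longrightarrow> completed n D e \<le> completed n D' e"
  unfolding completed_def by (rule card_mono) auto

lemma completed_pos_mono: "completed n D e > 0 \<Longrightarrow> D \<subseteq> D' \<Longrightarrow> completed n D' e > 0"
  using completed_mono[of D D' n e] by simp

lemma completed_pos: "T \<in> triangles n \<Longrightarrow> e \<in> T \<Longrightarrow> T \<subseteq> insert e D \<Longrightarrow> completed n D e > 0"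
  unfolding completed_def by (subst card_gt_0_iff) auto

lemma completed_le:
  assumes "\<And>T. T \<in> triangles n \<Longrightarrow> e \<in> T \<Longrightarrow> T \<subseteq> insert e D \<Longrightarrow> T \<in> set Ts"
  shows "completed n D e \<le> length Ts"
proof -
  have "completed n D e \<le> card (set Ts)"
    unfolding completed_def using assms by (intro card_mono) auto
  then show ?thesis using card_length[of Ts] by linarith
qed

section \<open>The minimax value of a position\<close>

text \<open>The best margin that the player to move can still achieve, whatever was claimed before.
  A capture keeps the turn, so the value of the new position is added to the gain; after any other
  move the opponent is to move, hence the sign.\<close>

function net :: "nat \<Rightarrow> edge set \<Rightarrow> int" where
  "net n D = (if edges n - D = {} then 0
     else Max ((\<lambda>e. if completed n D e > 0 then int (completed n D e) + net n (insert e D)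
                    else - net n (insert e D)) ` (edges n - D)))"
  by auto
termination
  by (relation "measure (\<lambda>(n, D). card (edges n - D))") (use card_undrawn_insert in auto)

declare net.simps [simp del]

lemma net_ge_capture:
  assumes "e \<in> edges n - D" "completed n D e > 0"
  shows "net n D \<ge> int (completed n D e) + net n (insert e D)"
  using assms by (subst net.simps) (auto intro!: Max_ge rev_image_eqI)

lemma net_ge_quiet:
  assumes "e \<in> edges n - D" "completed n D e = 0"
  shows "net n D \<ge> - net n (insert e D)"
  using assms by (subst net.simps) (auto intro!: Max_ge rev_image_eqI)

lemma net_ge_capture1:
  assumes "e \<in> edges n - D" "completed n D e > 0"
  shows "net n D \<ge> 1 + net n (insert e D)"
  using net_ge_capture[OF assms] assms by linarith

lemma net_cases:
  assumes "edges n - D \<noteq> {}"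
  obtains e where "e \<in> edges n - D" "completed n D e > 0"
      "net n D = int (completed n D e) + net n (insert e D)"
    | e where "e \<in> edges n - D" "completed n D e = 0" "net n D = - net n (insert e D)"
proof -
  let ?f = "\<lambda>e. if completed n D e > 0 then int (completed n D e) + net n (insert e D)
                    else - net n (insert e D)"
  have "Max (?f ` (edges n - D)) \<in> ?f ` (edges n - D)"
    using assms by (intro Max_in) auto
  moreover have "net n D = Max (?f ` (edges n - D))"
    using assms by (subst net.simps) auto
  ultimately obtain e where "e \<in> edges n - D" "net n D = ?f e" by auto
  then show ?thesis using that by (cases "completed n D e > 0") auto
qed

lemma net_finished: "edges n - D = {} \<Longrightarrow> net n D = 0"
  by (subst net.simps) auto

text \<open>On her own turn the first player draws an edge at which the maximum in
  \<open>net\<close> is attained; on the opponent's turn no edge brings the opponent more than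
  \<open>net n D\<close>. The inequality therefore survives every move, and at the end
  \<open>net\<close> is 0.\<close>

lemma first_wins_if_net_pos:
  assumes "int a + (if p then net n D else - net n D) > int b"
  shows "first_wins n D a b p"
  using assms
proof (induction "card (edges n - D)" arbitrary: D a b p rule: less_induct)
  case less
  show ?case
  proof (cases "edges n - D = {}")
    case True
    then show ?thesis using less.prems by (auto intro!: finished simp: net_finished split: if_splits)
  next
    case False
    show ?thesis
    proof (cases p)
      case True
      from False show ?thesis
      proof (cases rule: net_cases)
        case (1 e)
        have "first_wins n (insert e D) (a + completed n D e) b (completed n D e > 0)"
          using 1 True less.prems by (intro less.hyps card_undrawn_insert) auto
        with 1 True show ?thesis by (auto intro: first_move)
      next
        case (2 e)
        have "first_wins n (insert e D) (a + completed n D e) b (completed n D e > 0)"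
          using 2 True less.prems by (intro less.hyps card_undrawn_insert) auto
        with 2 True show ?thesis by (auto intro: first_move)
      qed
    next
      case p: False
      have "first_wins n (insert e D) a (b + completed n D e) (completed n D e = 0)"
        if e: "e \<in> edges n - D" for e
        using e p less.prems net_ge_capture[OF e] net_ge_quiet[OF e]
        by (intro less.hyps card_undrawn_insert) auto
      with False p show ?thesis by (auto intro: second_move)
    qed
  qed
qed

section \<open>Parity of the value\<close>

lemma completed_parity:
  assumes "e \<notin> D"
  shows "card {T \<in> triangles n. \<not> T \<subseteq> D}
       = completed n D e + card {T \<in> triangles n. \<not> T \<subseteq> insert e D}"
proof -
  have *: "{T \<in> triangles n. \<not> T \<subseteq> D} =
      {T \<in> triangles n. e \<in> T \<and> T \<subseteq> insert e D} \<union> {T \<in> triangles n. \<not> T \<subseteq> insert e D}"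
    using assms by auto
  show ?thesis unfolding completed_def * by (intro card_Un_disjoint) auto
qed

text \<open>A capture of \<open>c\<close> triangles accounts for \<open>c\<close> in both summands,
  and the change of sign after the other moves does not affect parity.\<close>

lemma net_parity: "even (net n D + int (card {T \<in> triangles n. \<not> T \<subseteq> D}))"
proof (induction "card (edges n - D)" arbitrary: D rule: less_induct)
  case less
  show ?case
  proof (cases "edges n - D = {}")
    case True
    have "T \<subseteq> edges n" if "T \<in> triangles n" for T
      using that unfolding triangles_def edges_def by auto
    with True have "{T \<in> triangles n. \<not> T \<subseteq> D} = {}" by blast
    then show ?thesis using True by (simp only: net_finished) simp
  next
    case False
    then show ?thesis
    proof (cases rule: net_cases)
      case (1 e)
      then show ?thesis using less[OF card_undrawn_insert[of e]] completed_parity[of e D n] by auto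
    next
      case (2 e)
      then show ?thesis using less[OF card_undrawn_insert[of e]] completed_parity[of e D n] by auto
    qed
  qed
qed

section \<open>When taking triangles is optimal\<close>

definition quiet :: "nat \<Rightarrow> edge set \<Rightarrow> bool" where
  "quiet n D \<longleftrightarrow> (\<forall>e \<in> edges n - D. completed n D e = 0)"

lemma quietD: "quiet n D' \<Longrightarrow> D \<subseteq> D' \<Longrightarrow> e \<in> edges n - D' \<Longrightarrow> completed n D e = 0"
  using completed_mono[of D D' n e] by (auto simp: quiet_def)

text \<open>Declining does not pay. After another move \<open>z\<close>, which captures nothing, the
  opponent can take \<open>e\<close> and is then to move. Taking \<open>e\<close> first and drawing
  \<open>z\<close> next leaves the opponent to move in the same position, but with the triangle on
  the other side of the account.\<close>

lemma net_le_take_one: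
  assumes e: "e \<in> edges n - D" and pos: "completed n D e = 1" and q: "quiet n (insert e D)"
  shows "net n D \<le> 1 + net n (insert e D)"
proof -
  have "edges n - D \<noteq> {}" using e by auto
  have *: "completed n D z = 0 \<and> - net n (insert z D) \<le> net n (insert e D)"
    if z: "z \<in> edges n - D" "z \<noteq> e" for z
  proof -
    have "completed n (insert z D) e > 0"
      using pos completed_pos_mono[of n D e "insert z D"] by auto
    then have "net n (insert z D) \<ge> 1 + net n (insert e (insert z D))"
      using e z by (intro net_ge_capture1) auto
    moreover have "net n (insert e D) \<ge> - net n (insert z (insert e D))"
      using z q by (intro net_ge_quiet) (auto simp: quiet_def)
    ultimately show ?thesis using z quietD[OF q, of D z] by (auto simp: insert_commute)
  qed
  from \<open>edges n - D \<noteq> {}\<close> show ?thesis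
  proof (cases rule: net_cases)
    case (1 f) then show ?thesis using *[of f] pos by (cases "f = e") auto
  next
    case (2 f) then show ?thesis using *[of f] pos by (cases "f = e") auto
  qed
qed

text \<open>The same comparison with two captures: after any other move \<open>z\<close> the
  opponent may take both. The captures do not depend on the order of \<open>e\<close> and
  \<open>f\<close>, so once one is taken, \<open>net_le_take_one\<close> covers the other.\<close>

lemma net_le_take_two:
  assumes e: "e \<in> edges n - D" "f \<in> edges n - D" "e \<noteq> f"
    and ce: "completed n D e = 1" "completed n (insert f D) e = 1"
    and cf: "completed n D f = 1" "completed n (insert e D) f = 1"
    and q: "quiet n (insert e (insert f D))"
  shows "net n D \<le> 2 + net n (insert e (insert f D))"
proof -
  have 1: "net n (insert e D) \<le> 1 + net n (insert e (insert f D))"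
    using net_le_take_one[of f n "insert e D"] assms by (auto simp: insert_commute)
  have 2: "net n (insert f D) \<le> 1 + net n (insert e (insert f D))"
    using net_le_take_one[of e n "insert f D"] assms by auto
  have *: "completed n D z = 0 \<and> - net n (insert z D) \<le> net n (insert e (insert f D))"
    if z: "z \<in> edges n - D" "z \<noteq> e" "z \<noteq> f" for z
  proof -
    have "completed n (insert z D) e > 0"
      using ce completed_pos_mono[of n D e "insert z D"] by auto
    then have "net n (insert z D) \<ge> 1 + net n (insert e (insert z D))"
      using e z by (intro net_ge_capture1) auto
    moreover have "completed n (insert e (insert z D)) f > 0"
      using cf completed_pos_mono[of n D f "insert e (insert z D)"] by auto
    then have "net n (insert e (insert z D)) \<ge> 1 + net n (insert f (insert e (insert z D)))"
      using e z by (intro net_ge_capture1) auto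
    moreover have "net n (insert e (insert f D)) \<ge> - net n (insert z (insert e (insert f D)))"
      using z q by (intro net_ge_quiet) (auto simp: quiet_def)
    ultimately show ?thesis using z quietD[OF q, of D z] by (auto simp: insert_commute)
  qed
  have "edges n - D \<noteq> {}" using e by auto
  then show ?thesis
  proof (cases rule: net_cases)
    case (1 g) then show ?thesis using *[of g] ce cf \<open>net n (insert e D) \<le> _\<close> 2
      by (cases "g = e"; cases "g = f") auto
  next
    case (2 g) then show ?thesis using *[of g] ce cf by (cases "g = e"; cases "g = f") auto
  qed
qed

text \<open>Every triangle at \<open>e\<close> lacks only \<open>e\<close>, so drawing
  \<open>e\<close> changes no other capture and commutes with all other moves. By induction,
  postponing \<open>e\<close> past another capture gains nothing, and postponing it past a move
  without capture gives its triangles away.\<close>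

lemma net_le_take_isolated:
  assumes "e \<in> edges n - D" "completed n D e > 0"
    and "\<And>T. T \<in> triangles n \<Longrightarrow> e \<in> T \<Longrightarrow> T \<subseteq> insert e D"
  shows "net n D \<le> int (completed n D e) + net n (insert e D)"
  using assms
proof (induction "card (edges n - D)" arbitrary: D rule: less_induct)
  case less
  note e = less.prems(1) and pos = less.prems(2) and iso = less.prems(3)
  have same: "completed n (insert z D) e = completed n D e" for z
    unfolding completed_def by (rule arg_cong[where f = card]) (use iso in blast)
  have other: "completed n (insert e D) z = completed n D z" if "z \<in> edges n - D" "z \<noteq> e" for z
    unfolding completed_def by (rule arg_cong[where f = card]) (use iso that in blast)
  have step: "net n (insert z D) \<le> int (completed n D e) + net n (insert z (insert e D))"
    and step': "net n (insert z D) \<ge> int (completed n D e) + net n (insert z (insert e D))"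
    if z: "z \<in> edges n - D" "z \<noteq> e" for z
  proof -
    have "net n (insert z D) \<le> int (completed n (insert z D) e) + net n (insert e (insert z D))"
      using e z pos iso by (intro less.hyps card_undrawn_insert) (auto simp: same)
    then show "net n (insert z D) \<le> int (completed n D e) + net n (insert z (insert e D))"
      by (simp add: same insert_commute)
    show "net n (insert z D) \<ge> int (completed n D e) + net n (insert z (insert e D))"
      using net_ge_capture[of e n "insert z D"] e z pos by (auto simp: same insert_commute)
  qed
  have "edges n - D \<noteq> {}" using e by auto
  then show ?case
  proof (cases rule: net_cases)
    case (1 g) then show ?thesis
      using net_ge_capture[of g n "insert e D"] other[of g] step[of g] by (cases "g = e") auto
  next
    case (2 g) then show ?thesis
      using net_ge_quiet[of g n "insert e D"] other[of g] step'[of g] pos by (cases "g = e") auto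
  qed
qed

text \<open>The double-dealing choice of Dots and Boxes. Let \<open>r\<close> be the value after
  \<open>e\<close> and \<open>g\<close>. Drawing \<open>e\<close> and then \<open>g\<close> yields
  at least \<open>2 + r\<close>. Drawing \<open>g\<close> alone offers \<open>X\<close> and
  \<open>Y\<close> to the opponent, who gets at most two triangles by \<open>e\<close> and must then
  move, so it yields at least \<open>-(2 + r)\<close>. One of the two numbers is
  nonnegative.\<close>

lemma net_nonneg_run:
  assumes e: "e \<in> edges n - D" "g \<in> edges n - D" "e \<noteq> g"
    and X: "X \<in> triangles n" "e \<in> X" "X \<subseteq> insert e D"
    and Y: "Y \<in> triangles n" "e \<in> Y" "g \<in> Y" "Y \<subseteq> insert e (insert g D)"
    and only_e: "\<And>T. T \<in> triangles n \<Longrightarrow> e \<in> T \<Longrightarrow> T = X \<or> T = Y"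
    and g: "completed n D g = 0"
  shows "net n D \<ge> 0"
proof -
  have "net n D \<ge> 1 + net n (insert e D)"
    using e X by (intro net_ge_capture1 completed_pos[of X]) auto
  moreover have "net n (insert e D) \<ge> 1 + net n (insert e (insert g D))"
    using e Y net_ge_capture1[of g n "insert e D"] completed_pos[of Y n g "insert e D"]
    by (auto simp: insert_commute)
  moreover have "net n D \<ge> - net n (insert g D)"
    using e g by (intro net_ge_quiet) auto
  moreover have "net n (insert g D) \<le> int (completed n (insert g D) e) + net n (insert e (insert g D))"
    using e X Y only_e by (intro net_le_take_isolated completed_pos[of X]) blast+
  moreover have "completed n (insert g D) e \<le> 2"
    using completed_le[of n e "insert g D" "[X, Y]"] only_e by auto
  ultimately show ?thesis by linarith
qed


section \<open>The strip of triangles\<close>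

text \<open>Abstracting from the edges of the board makes the reversed numbering a second instance,
  so that what is proved for one direction along the strip holds for the other.\<close>

locale strip =
  fixes m :: nat and P Q :: "nat \<Rightarrow> edge"
  assumes P_inj [simp]: "i \<le> 2*m+1 \<Longrightarrow> j \<le> 2*m+1 \<Longrightarrow> P i = P j \<longleftrightarrow> i = j"
    and Q_inj [simp]: "i \<le> 2*m \<Longrightarrow> j \<le> 2*m \<Longrightarrow> Q i = Q j \<longleftrightarrow> i = j"
    and P_neq_Q [simp]: "i \<le> 2*m+1 \<Longrightarrow> j \<le> 2*m \<Longrightarrow> P i \<noteq> Q j"
    and edges_eq: "edges (Suc m) = P ` {..2*m+1} \<union> Q ` {..2*m}"
    and triangles_eq: "triangles (Suc m) = (\<lambda>k. {P k, P (Suc k), Q k}) ` {..2*m}"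
begin

lemma Q_neq_P [simp]: "i \<le> 2*m+1 \<Longrightarrow> j \<le> 2*m \<Longrightarrow> Q j \<noteq> P i"
  using P_neq_Q by metis

lemma P_edge [simp]: "k \<le> 2*m+1 \<Longrightarrow> P k \<in> edges (Suc m)"
  and Q_edge [simp]: "k \<le> 2*m \<Longrightarrow> Q k \<in> edges (Suc m)"
  by (auto simp: edges_eq)

lemma edge_cases:
  assumes "e \<in> edges (Suc m)"
  obtains k where "k \<le> 2*m+1" "e = P k" | k where "k \<le> 2*m" "e = Q k"
  using assms by (auto simp: edges_eq)

text \<open>In the dual game Strings and Coins, triangles are coins and their undrawn sides are the
  strings attached to them.\<close>

definition coin :: "nat \<Rightarrow> edge set" where
  "coin k = {P k, P (Suc k), Q k}"

lemma inj_coin: "inj_on coin {..2*m}"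
proof (rule inj_onI)
  fix i j assume "i \<in> {..2*m}" "j \<in> {..2*m}" "coin i = coin j"
  moreover have "Q i \<in> coin i" by (simp add: coin_def)
  ultimately show "i = j" by (simp add: coin_def)
qed

lemma coin_triangle [simp]: "k \<le> 2*m \<Longrightarrow> coin k \<in> triangles (Suc m)"
  by (auto simp: triangles_eq coin_def)

lemma completed_eq: "completed (Suc m) D e = card {k \<in> {..2*m}. e \<in> coin k \<and> coin k \<subseteq> insert e D}"
proof -
  have eq: "{T \<in> triangles (Suc m). e \<in> T \<and> T \<subseteq> insert e D}
      = coin ` {k \<in> {..2*m}. e \<in> coin k \<and> coin k \<subseteq> insert e D}"
    by (auto simp: triangles_eq coin_def)
  show ?thesis
    unfolding completed_def eq by (rule card_image, rule inj_on_subset[OF inj_coin]) blast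
qed

lemma completed_Q:
  assumes "k \<le> 2*m"
  shows "completed (Suc m) D (Q k) = (if P k \<in> D \<and> P (Suc k) \<in> D then 1 else 0)"
proof -
  have "{j \<in> {..2*m}. Q k \<in> coin j \<and> coin j \<subseteq> insert (Q k) D}
      = (if P k \<in> D \<and> P (Suc k) \<in> D then {k} else {})"
    (is "_ = ?R")
  proof -
    have "Q k \<in> coin j \<longleftrightarrow> j = k" if "j \<le> 2*m" for j
      using assms that by (simp add: coin_def eq_commute)
    then have "j \<in> {..2*m} \<and> Q k \<in> coin j \<and> coin j \<subseteq> insert (Q k) D \<longleftrightarrow> j \<in> ?R" for j
      using assms by (cases "j = k") (simp_all add: coin_def)
    then show ?thesis by blast
  qed
  then show ?thesis by (simp add: completed_eq)
qed

text \<open>The bound on \<open>k\<close> leaves out \<open>P 0\<close> and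
  \<open>P (2*m+1)\<close>, which lie in a single triangle; every other path edge separates
  triangles \<open>k\<close> and \<open>Suc k\<close>.\<close>

lemma completed_P:
  assumes "k < 2*m"
  shows "completed (Suc m) D (P (Suc k)) = (if P k \<in> D \<and> Q k \<in> D then 1 else 0)
     + (if P (Suc (Suc k)) \<in> D \<and> Q (Suc k) \<in> D then 1 else 0)"
proof -
  have "{j \<in> {..2*m}. P (Suc k) \<in> coin j \<and> coin j \<subseteq> insert (P (Suc k)) D}
      = (if P k \<in> D \<and> Q k \<in> D then {k} else {})
      \<union> (if P (Suc (Suc k)) \<in> D \<and> Q (Suc k) \<in> D then {Suc k} else {})"
    (is "_ = ?R")
  proof -
    have "P (Suc k) \<in> coin j \<longleftrightarrow> j = k \<or> j = Suc k" if "j \<le> 2*m" for j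
      using assms that by (auto simp: coin_def)
    then have "j \<in> {..2*m} \<and> P (Suc k) \<in> coin j \<and> coin j \<subseteq> insert (P (Suc k)) D \<longleftrightarrow> j \<in> ?R" for j
      using assms by (cases "j = k"; cases "j = Suc k") (simp_all add: coin_def)
    then show ?thesis by blast
  qed
  then show ?thesis by (simp add: completed_eq)
qed

section \<open>Inert and balanced positions\<close>

text \<open>The edges listed first are those drawn from the start. The three implications together
  say that no triangle lacks exactly one side. Hence the two path sides of an odd triangle are both
  drawn or both undrawn.\<close>

definition inert :: "edge set \<Rightarrow> bool" where
  "inert D \<longleftrightarrow> P 0 \<in> D \<and> P (2*m+1) \<in> D \<and> (\<forall>k\<le>2*m. odd k \<longrightarrow> Q k \<in> D) \<and>
     (\<forall>k\<le>2*m. (P k \<in> D \<and> P (Suc k) \<in> D \<longrightarrow> Q k \<in> D) \<and> (P k \<in> D \<and> Q k \<in> D \<longrightarrow> P (Suc k) \<in> D)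
        \<and> (P (Suc k) \<in> D \<and> Q k \<in> D \<longrightarrow> P k \<in> D))"

text \<open>The conditions on the centre exclude a self-mirrored triangle with three undrawn sides and a
  self-mirrored chain of one triangle, neither of which leaves a mirrored move as an answer.\<close>

definition balanced :: "edge set \<Rightarrow> bool" where
  "balanced D \<longleftrightarrow> inert D \<and> (\<forall>k\<le>2*m+1. P k \<in> D \<longleftrightarrow> P (2*m+1-k) \<in> D) \<and>
     (\<forall>k\<le>2*m. Q k \<in> D \<longleftrightarrow> Q (2*m-k) \<in> D) \<and>
     Q m \<in> D \<and> (P m \<in> D \<or> m \<ge> 1 \<and> Q (m-1) \<in> D)"

text \<open>The induction hypothesis of \<open>balanced_losing\<close>, named so that each kind of
  move can have its own lemma and be carried over by reflection.\<close>

definition losing_above :: "edge set \<Rightarrow> bool" where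
  "losing_above D \<longleftrightarrow> (\<forall>D'. card (edges (Suc m) - D') < card (edges (Suc m) - D) \<longrightarrow>
     edges (Suc m) - D' \<noteq> {} \<longrightarrow> balanced D' \<longrightarrow> net (Suc m) D' < 0)"

lemma inertD:
  assumes "inert D"
  shows "P 0 \<in> D" "P (2*m+1) \<in> D" "\<And>k. k \<le> 2*m \<Longrightarrow> odd k \<Longrightarrow> Q k \<in> D"
    and "\<And>k. k \<le> 2*m \<Longrightarrow> P k \<in> D \<Longrightarrow> P (Suc k) \<in> D \<Longrightarrow> Q k \<in> D"
    and "\<And>k. k \<le> 2*m \<Longrightarrow> P k \<in> D \<Longrightarrow> Q k \<in> D \<Longrightarrow> P (Suc k) \<in> D"
    and "\<And>k. k \<le> 2*m \<Longrightarrow> P (Suc k) \<in> D \<Longrightarrow> Q k \<in> D \<Longrightarrow> P k \<in> D"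
  using assms unfolding inert_def by blast+

lemma P_undrawn_cases:
  assumes "P 0 \<in> D" "P (2*m+1) \<in> D" "e \<in> edges (Suc m) - D"
  obtains k where "k < 2*m" "e = P (Suc k)" "P (Suc k) \<notin> D" | k where "k \<le> 2*m" "e = Q k" "Q k \<notin> D"
proof -
  from assms have "e \<in> edges (Suc m)" "e \<notin> D" by auto
  then show ?thesis
  proof (cases rule: edge_cases)
    case (1 k)
    with \<open>e \<notin> D\<close> have "k \<noteq> 0" "k \<noteq> 2*m+1" using assms(1,2) by (rule_tac notI; simp)+
    then obtain j where "k = Suc j" "j < 2*m" using 1(1) by (cases k) auto
    then show ?thesis using that(1) 1 \<open>e \<notin> D\<close> by blast
  next
    case (2 k)
    then show ?thesis using that(2) \<open>e \<notin> D\<close> by blast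
  qed
qed

lemma inert_quiet:
  assumes "inert D"
  shows "quiet (Suc m) D"
  unfolding quiet_def
proof
  note D = inertD[OF assms]
  fix e assume "e \<in> edges (Suc m) - D"
  with D(1,2) show "completed (Suc m) D e = 0"
  proof (cases rule: P_undrawn_cases)
    case (1 k)
    then show ?thesis using D(5)[of k] D(6)[of "Suc k"] by (auto simp: completed_P)
  next
    case (2 k)
    then show ?thesis using D(4)[of k] by (auto simp: completed_Q)
  qed
qed

end

section \<open>Reflection of the strip\<close>

lemma strip_mirror:
  assumes "strip m P Q"
  shows "strip m (\<lambda>k. P (2*m+1-k)) (\<lambda>k. Q (2*m-k))"
proof -
  interpret strip m P Q by fact
  have P: "(\<lambda>k. P (2*m+1-k)) ` {..2*m+1} = P ` {..2*m+1}"
  proof -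
    have "(\<lambda>k. 2*m+1-k) ` {..2*m+1} = {..2*m+1}"
      by (auto simp: image_iff) (metis atMost_iff diff_diff_cancel diff_le_self)
    then show ?thesis by (metis (no_types, lifting) image_cong image_image)
  qed
  have M: "(\<lambda>k. 2*m-k) ` {..2*m} = {..2*m}"
    by (auto simp: image_iff) (metis atMost_iff diff_diff_cancel diff_le_self)
  then have Q: "(\<lambda>k. Q (2*m-k)) ` {..2*m} = Q ` {..2*m}"
    by (metis (no_types, lifting) image_cong image_image)
  have "(\<lambda>k. {P k, P (Suc k), Q k}) ` {..2*m}
      = (\<lambda>k. {P (2*m-k), P (Suc (2*m-k)), Q (2*m-k)}) ` {..2*m}"
    using M by (metis (no_types, lifting) image_cong image_image)
  also have "\<dots> = (\<lambda>k. {P (2*m+1-k), P (2*m+1-Suc k), Q (2*m-k)}) ` {..2*m}"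
    by (rule image_cong) (auto simp: Suc_diff_le)
  finally show ?thesis
    using edges_eq triangles_eq P Q by unfold_locales auto
qed

lemma all_le_mirror: "(\<forall>k\<le>N. R (N - k)) \<longleftrightarrow> (\<forall>k\<le>N. R k)" for N :: nat
  by (metis diff_diff_cancel diff_le_self)

context strip
begin

lemma mirror_strip: "strip m (\<lambda>k. P (2*m+1-k)) (\<lambda>k. Q (2*m-k))"
  by (rule strip_mirror) unfold_locales

interpretation mirror: strip m "\<lambda>k. P (2*m+1-k)" "\<lambda>k. Q (2*m-k)"
  by (rule mirror_strip)

lemma inert_mirror: "mirror.inert D \<longleftrightarrow> inert D"
proof -
  have r: "Suc (2*m)-k = Suc (2*m-k)" "2*m+1-Suc k = 2*m-k" "odd (2*m-k) \<longleftrightarrow> odd k"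
    if "k \<le> 2*m" for k
    using that by auto
  let ?R = "\<lambda>k. (odd k \<longrightarrow> Q k \<in> D)"
  let ?S = "\<lambda>k. (P k \<in> D \<and> P (Suc k) \<in> D \<longrightarrow> Q k \<in> D) \<and> (P k \<in> D \<and> Q k \<in> D \<longrightarrow> P (Suc k) \<in> D)
        \<and> (P (Suc k) \<in> D \<and> Q k \<in> D \<longrightarrow> P k \<in> D)"
  have "inert D \<longleftrightarrow> P 0 \<in> D \<and> P (2*m+1) \<in> D \<and> (\<forall>k\<le>2*m. ?R (2*m-k)) \<and> (\<forall>k\<le>2*m. ?S (2*m-k))"
    unfolding inert_def all_le_mirror[of "2*m" ?R] all_le_mirror[of "2*m" ?S] ..
  also have "\<dots> \<longleftrightarrow> mirror.inert D"
    unfolding mirror.inert_def by (simp add: r conj_ac cong: imp_cong)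
  finally show ?thesis ..
qed

text \<open>Only the condition on the centre is not visibly invariant. Its reflection speaks of
  \<open>P (m+1)\<close> and \<open>Q (m+1)\<close>, which agree with \<open>P m\<close> and
  \<open>Q (m-1)\<close> by the symmetry of the position.\<close>

lemma balanced_mirror: "mirror.balanced D \<longleftrightarrow> balanced D"
proof -
  have P: "(\<forall>k\<le>2*m+1. P (2*m+1-k) \<in> D \<longleftrightarrow> P (2*m+1-(2*m+1-k)) \<in> D)
      \<longleftrightarrow> (\<forall>k\<le>2*m+1. P k \<in> D \<longleftrightarrow> P (2*m+1-k) \<in> D)"
    by (rule all_le_mirror)
  have Q: "(\<forall>k\<le>2*m. Q (2*m-k) \<in> D \<longleftrightarrow> Q (2*m-(2*m-k)) \<in> D)
      \<longleftrightarrow> (\<forall>k\<le>2*m. Q k \<in> D \<longleftrightarrow> Q (2*m-k) \<in> D)"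
    by (rule all_le_mirror)
  have "P (2*m+1-m) \<in> D \<longleftrightarrow> P m \<in> D" if "\<forall>k\<le>2*m+1. P k \<in> D \<longleftrightarrow> P (2*m+1-k) \<in> D"
    using that[rule_format, of m] by simp
  moreover have "Q (2*m-(m-1)) \<in> D \<longleftrightarrow> Q (m-1) \<in> D" if "\<forall>k\<le>2*m. Q k \<in> D \<longleftrightarrow> Q (2*m-k) \<in> D"
    using that[rule_format, of "m-1"] by simp
  moreover have "2*m-m = m" by simp
  ultimately show ?thesis
    unfolding mirror.balanced_def balanced_def inert_mirror P Q by metis
qed

section \<open>Runs of two triangles\<close>

text \<open>An instance of \<open>net_nonneg_run\<close> with triangles \<open>k\<close> and
  \<open>k+1\<close>. By \<open>one\<close>, triangle \<open>k+1\<close> has exactly one undrawn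
  side \<open>g\<close> besides \<open>P (Suc k)\<close>; by \<open>far\<close>, drawing
  \<open>g\<close> does not complete triangle \<open>k+2\<close>.\<close>

lemma run_right:
  assumes k: "k < 2*m" "P (2*m+1) \<in> D"
    and D: "P k \<in> D" "Q k \<in> D" "P (Suc k) \<notin> D"
    and one: "Q (Suc k) \<in> D \<longleftrightarrow> P (Suc (Suc k)) \<notin> D"
    and far: "P (Suc (Suc k)) \<notin> D \<Longrightarrow> \<not> (P (Suc (Suc (Suc k))) \<in> D \<and> Q (Suc (Suc k)) \<in> D)"
  shows "net (Suc m) D \<ge> 0"
proof -
  define g where "g = (if Q (Suc k) \<in> D then P (Suc (Suc k)) else Q (Suc k))"
  show ?thesis
  proof (rule net_nonneg_run)
    show "P (Suc k) \<in> edges (Suc m) - D" "g \<in> edges (Suc m) - D" "P (Suc k) \<noteq> g"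
      using k D one by (auto simp: g_def)
    show "coin k \<in> triangles (Suc m)" "coin (Suc k) \<in> triangles (Suc m)"
      using k by simp_all
    show "P (Suc k) \<in> coin k" "coin k \<subseteq> insert (P (Suc k)) D"
      using k D by (auto simp: coin_def)
    show "P (Suc k) \<in> coin (Suc k)" "g \<in> coin (Suc k)"
         "coin (Suc k) \<subseteq> insert (P (Suc k)) (insert g D)"
      using k one by (auto simp: coin_def g_def)
    show "T = coin k \<or> T = coin (Suc k)" if "T \<in> triangles (Suc m)" "P (Suc k) \<in> T" for T
    proof -
      obtain j where j: "j \<le> 2*m" "T = coin j" using \<open>T \<in> _\<close> by (auto simp: triangles_eq coin_def)
      then show ?thesis using that(2) k by (auto simp: coin_def)
    qed
    show "completed (Suc m) D g = 0"
    proof (cases "Q (Suc k) \<in> D")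
      case True
      with one have P: "P (Suc (Suc k)) \<notin> D" by simp
      with k have "Suc (Suc k) \<noteq> 2*m+1" by metis
      with k have "Suc k < 2*m" by simp
      then show ?thesis using True D P far by (auto simp: g_def completed_P)
    next
      case False
      then show ?thesis using k D by (simp add: g_def completed_Q)
    qed
  qed
qed

text \<open>The reflection of \<open>run_right\<close>. The truncated \<open>k - 1\<close> is
  harmless at \<open>k = 0\<close>, where \<open>P 0 \<in> D\<close> makes \<open>far\<close>
  vacuous.\<close>

lemma run_left:
  assumes k: "k < 2*m" "P 0 \<in> D"
    and D: "P (Suc (Suc k)) \<in> D" "Q (Suc k) \<in> D" "P (Suc k) \<notin> D"
    and one: "Q k \<in> D \<longleftrightarrow> P k \<notin> D"
    and far: "P k \<notin> D \<Longrightarrow> \<not> (P (k - 1) \<in> D \<and> Q (k - 1) \<in> D)"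
  shows "net (Suc m) D \<ge> 0"
proof -
  \<comment> \<open>Triangle \<open>Suc k\<close>, the one that can be claimed at once, is triangle
    \<open>j\<close> of the reversed strip.\<close>
  define j where "j = 2*m-1-k"
  have eqs: "2*m+1-j = Suc (Suc k)" "2*m-j = Suc k" "2*m+1-Suc j = Suc k" "2*m-Suc j = k"
     "2*m+1-Suc (Suc j) = k" "2*m+1-Suc (Suc (Suc j)) = k - 1" "2*m-Suc (Suc j) = k-1"
     "2*m+1-(2*m+1) = 0"
    using k by (auto simp: j_def)
  show ?thesis
    by (rule strip.run_right[OF mirror_strip, of j D, unfolded eqs]) (use assms in \<open>simp_all add: j_def\<close>)
qed

section \<open>Mirrored pairs of moves preserve balance\<close>

lemma balancedD:
  assumes "balanced D"
  shows "inert D" "Q m \<in> D" "P m \<in> D \<or> m \<ge> 1 \<and> Q (m-1) \<in> D"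
    and "c + d = 2*m+1 \<Longrightarrow> P c \<in> D \<longleftrightarrow> P d \<in> D"
    and "c + d = 2*m \<Longrightarrow> Q c \<in> D \<longleftrightarrow> Q d \<in> D"
proof -
  show "P c \<in> D \<longleftrightarrow> P d \<in> D" if "c + d = 2*m+1"
  proof -
    have "c \<le> 2*m+1" "2*m+1-c = d" using that by auto
    then show ?thesis using assms unfolding balanced_def by metis
  qed
  show "Q c \<in> D \<longleftrightarrow> Q d \<in> D" if "c + d = 2*m"
  proof -
    have "c \<le> 2*m" "2*m-c = d" using that by auto
    then show ?thesis using assms unfolding balanced_def by metis
  qed
qed (use assms in \<open>unfold balanced_def, blast+\<close>)

lemma balancedI:
  assumes "inert D" "Q m \<in> D" "P m \<in> D \<or> m \<ge> 1 \<and> Q (m-1) \<in> D"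
    and "\<And>c d. c + d = 2*m+1 \<Longrightarrow> P c \<in> D \<Longrightarrow> P d \<in> D"
    and "\<And>c d. c + d = 2*m \<Longrightarrow> Q c \<in> D \<Longrightarrow> Q d \<in> D"
  shows "balanced D"
  unfolding balanced_def
proof (intro conjI allI impI)
  fix k assume "k \<le> 2*m+1"
  then have "k + (2*m+1-k) = 2*m+1" "(2*m+1-k) + k = 2*m+1" by auto
  then show "P k \<in> D \<longleftrightarrow> P (2*m+1-k) \<in> D" using assms(4) by blast
next
  fix k assume "k \<le> 2*m"
  then have "k + (2*m-k) = 2*m" "(2*m-k) + k = 2*m" by auto
  then show "Q k \<in> D \<longleftrightarrow> Q (2*m-k) \<in> D" using assms(5) by blast
qed (use assms(1-3) in auto)

lemma balanced_joint:
  assumes D: "balanced D" and k: "k + l = 2*m"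
    and und: "Q k \<notin> D" "P k \<notin> D" "P (Suc k) \<notin> D"
  shows "balanced (insert (Q l) (insert (Q k) D))" (is "balanced ?X")
proof -
  note bal = balancedD[OF D] and I = inertD[OF balancedD(1)[OF D]]
  have und': "P l \<notin> D" "P (Suc l) \<notin> D"
    using und bal(4)[of k "Suc l"] bal(4)[of "Suc k" l] k by auto
  have mP: "P i \<in> ?X \<longleftrightarrow> P i \<in> D" if "i \<le> 2*m+1" for i
    using that k by auto
  have mQ: "Q i \<in> ?X \<longleftrightarrow> Q i \<in> D \<or> i = k \<or> i = l" if "i \<le> 2*m" for i
    using that k by auto
  show ?thesis
  proof (rule balancedI)
    show "inert ?X"
      unfolding inert_def
    proof (intro conjI[OF _ conjI[OF _ conjI]] allI impI)
      fix i assume i: "i \<le> 2*m"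
      show "(P i \<in> ?X \<and> P (Suc i) \<in> ?X \<longrightarrow> Q i \<in> ?X) \<and> (P i \<in> ?X \<and> Q i \<in> ?X \<longrightarrow> P (Suc i) \<in> ?X)
        \<and> (P (Suc i) \<in> ?X \<and> Q i \<in> ?X \<longrightarrow> P i \<in> ?X)"
      proof (cases "i = k \<or> i = l")
        case True
        then show ?thesis using i und und' by (auto simp: mP simp del: insert_iff)
      next
        case False
        then have eqs: "P i \<in> ?X \<longleftrightarrow> P i \<in> D" "P (Suc i) \<in> ?X \<longleftrightarrow> P (Suc i) \<in> D" "Q i \<in> ?X \<longleftrightarrow> Q i \<in> D"
          using i mP[of i] mP[of "Suc i"] mQ[of i] by simp_all
        show ?thesis unfolding eqs using I(4-6)[OF i] by blast
      qed
    qed (use I(1-3) in auto)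
  next
    fix c d assume cd: "c + d = 2*m+1" "P c \<in> ?X"
    then show "P d \<in> ?X" using bal(4)[OF cd(1)] mP[of c] mP[of d] by simp
  next
    fix c d assume cd: "c + d = 2*m" "Q c \<in> ?X"
    then have "Q c \<in> D \<or> c = k \<or> c = l" using mQ[of c] by simp
    moreover have "c = k \<Longrightarrow> d = l" "c = l \<Longrightarrow> d = k" using cd(1) k by auto
    ultimately show "Q d \<in> ?X" using bal(5)[OF cd(1)] by auto
  qed (use bal(2,3) in auto)
qed

text \<open>Triangles \<open>j+1\<close> and \<open>b+1\<close> are mirror images, each a chain of
  its own between two joints. Claiming both costs every adjacent joint one side. The inequalities
  say that the joints \<open>j\<close>, \<open>j+2\<close>, \<open>b\<close>, \<open>b+2\<close> are
  distinct, so each keeps two undrawn sides.\<close>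

lemma balanced_single:
  assumes D: "balanced D" and jb: "Suc (Suc (j + b)) = 2*m" and "even j"
    and und: "P (Suc j) \<notin> D" "P (Suc (Suc j)) \<notin> D"
      "Q j \<notin> D" "Q (Suc (Suc j)) \<notin> D" "P j \<notin> D" "P (Suc (Suc (Suc j))) \<notin> D"
  shows "balanced (D \<union> {P (Suc j), P (Suc (Suc j)), P (Suc b), P (Suc (Suc b))})" (is "balanced ?X")
    and "j \<noteq> b" "j \<noteq> Suc (Suc b)" "b \<noteq> Suc (Suc j)"
proof -
  note bal = balancedD[OF D] and I = inertD[OF balancedD(1)[OF D]]
  define X where "X = ?X"
  have und': "P b \<notin> D" "P (Suc (Suc (Suc b))) \<notin> D" "Q b \<notin> D" "Q (Suc (Suc b)) \<notin> D"
    using und jb bal(4)[of j "Suc (Suc (Suc b))"] bal(4)[of "Suc (Suc (Suc j))" b]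
      bal(5)[of j "Suc (Suc b)"] bal(5)[of "Suc (Suc j)" b] by auto
  have jm: "j \<noteq> m" "Suc (Suc j) \<noteq> m" using und bal(2) by metis+
  \<comment> \<open>For a chain at the centre, \<open>P m\<close> and \<open>Q (m-1)\<close> would
    be the undrawn edges \<open>P (Suc j)\<close> and \<open>Q j\<close>.\<close>
  have "Suc j \<noteq> m" using und bal(3) by auto
  with jm jb show ne: "j \<noteq> b" "j \<noteq> Suc (Suc b)" "b \<noteq> Suc (Suc j)" by auto
  have "even b" using jb \<open>even j\<close> by presburger
  then have par: "j \<noteq> Suc b" "b \<noteq> Suc j" using \<open>even j\<close> by auto
  have mP: "P i \<in> X \<longleftrightarrow> P i \<in> D \<or> i = Suc j \<or> i = Suc (Suc j) \<or> i = Suc b \<or> i = Suc (Suc b)"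
    if "i \<le> 2*m+1" for i
    using that jb by (auto simp: X_def)
  have mQ: "Q i \<in> X \<longleftrightarrow> Q i \<in> D" if "i \<le> 2*m" for i
    using that jb by (auto simp: X_def)
  have X: "P j \<notin> X" "P (Suc (Suc (Suc j))) \<notin> X" "P b \<notin> X" "P (Suc (Suc (Suc b))) \<notin> X"
    "Q j \<notin> X" "Q (Suc (Suc j)) \<notin> X" "Q b \<notin> X" "Q (Suc (Suc b)) \<notin> X"
    using und und' ne par jb by (auto simp: X_def)
  have "Q (Suc j) \<in> X" "Q (Suc b) \<in> X"
      "P (Suc j) \<in> X" "P (Suc (Suc j)) \<in> X" "P (Suc b) \<in> X" "P (Suc (Suc b)) \<in> X"
    using I(3)[of "Suc j"] I(3)[of "Suc b"] \<open>even b\<close> \<open>even j\<close> jb by (auto simp: X_def)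
  note X = X this
  have "balanced X"
  proof (rule balancedI)
    show "inert X"
      unfolding inert_def
    proof (intro conjI[OF _ conjI[OF _ conjI]] allI impI)
      fix i assume i: "i \<le> 2*m"
      show "(P i \<in> X \<and> P (Suc i) \<in> X \<longrightarrow> Q i \<in> X) \<and> (P i \<in> X \<and> Q i \<in> X \<longrightarrow> P (Suc i) \<in> X)
        \<and> (P (Suc i) \<in> X \<and> Q i \<in> X \<longrightarrow> P i \<in> X)"
      proof (cases "i \<in> {j, Suc j, Suc (Suc j), b, Suc b, Suc (Suc b)}")
        case True
        then show ?thesis using X by auto
      next
        case False
        then have eqs: "P i \<in> X \<longleftrightarrow> P i \<in> D" "P (Suc i) \<in> X \<longleftrightarrow> P (Suc i) \<in> D" "Q i \<in> X \<longleftrightarrow> Q i \<in> D"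
          using i mP[of i] mP[of "Suc i"] mQ[of i] by simp_all
        show ?thesis unfolding eqs using I(4-6)[OF i] by blast
      qed
    qed (use I(1-3) in \<open>auto simp: X_def\<close>)
  next
    fix c d assume cd: "c + d = 2*m+1" "P c \<in> X"
    then have "P c \<in> D \<or> c = Suc j \<or> c = Suc (Suc j) \<or> c = Suc b \<or> c = Suc (Suc b)"
      using mP[of c] by simp
    moreover have "c = Suc j \<Longrightarrow> d = Suc (Suc b)" "c = Suc (Suc j) \<Longrightarrow> d = Suc b"
      "c = Suc b \<Longrightarrow> d = Suc (Suc j)" "c = Suc (Suc b) \<Longrightarrow> d = Suc j"
      using cd(1) jb by auto
    ultimately show "P d \<in> X" using bal(4)[OF cd(1)] mP[of c] mP[of d] jb cd by auto
  next
    fix c d assume cd: "c + d = 2*m" "Q c \<in> X"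
    then show "Q d \<in> X" using bal(5)[OF cd(1)] mQ[of c] mQ[of d] by simp
  qed (use bal(2,3) in \<open>auto simp: X_def\<close>)
  then show "balanced ?X" by (simp only: X_def)
qed

text \<open>The chain consists of triangles \<open>j\<close> and \<open>j+1\<close>, stops at the
  drawn edge \<open>P j\<close> and hangs on the joint \<open>j+2\<close>. Its mirror image consists
  of \<open>b+2\<close> and \<open>b+1\<close> and hangs on \<open>b\<close>. The two joints are
  distinct and lose one side each.\<close>

lemma balanced_end:
  assumes D: "balanced D" and jb: "Suc (Suc (j + b)) = 2*m" and "even j"
    and und: "P (Suc j) \<notin> D" "P (Suc (Suc j)) \<notin> D"
      "Q j \<notin> D" "Q (Suc (Suc j)) \<notin> D" "P j \<in> D" "P (Suc (Suc (Suc j))) \<notin> D"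
  shows "balanced (D \<union> {Q j, P (Suc j), P (Suc (Suc j)), P (Suc b), P (Suc (Suc b)), Q (Suc (Suc b))})"
      (is "balanced ?X")
    and "j \<noteq> b" "j \<noteq> Suc (Suc b)" "b \<noteq> Suc (Suc j)"
proof -
  note bal = balancedD[OF D] and I = inertD[OF balancedD(1)[OF D]]
  define X where "X = ?X"
  have und': "P b \<notin> D" "P (Suc (Suc (Suc b))) \<in> D" "Q b \<notin> D" "Q (Suc (Suc b)) \<notin> D"
    using und jb bal(4)[of j "Suc (Suc (Suc b))"] bal(4)[of "Suc (Suc (Suc j))" b]
      bal(5)[of j "Suc (Suc b)"] bal(5)[of "Suc (Suc j)" b] by auto
  have jm: "j \<noteq> m" "Suc (Suc j) \<noteq> m" using und bal(2) by metis+
  have "Suc j \<noteq> m" using und bal(3) by auto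
  with jm jb show ne: "j \<noteq> b" "j \<noteq> Suc (Suc b)" "b \<noteq> Suc (Suc j)" by auto
  have "even b" using jb \<open>even j\<close> by presburger
  then have par: "j \<noteq> Suc b" "b \<noteq> Suc j" using \<open>even j\<close> by auto
  have mP: "P i \<in> X \<longleftrightarrow> P i \<in> D \<or> i = Suc j \<or> i = Suc (Suc j) \<or> i = Suc b \<or> i = Suc (Suc b)"
    if "i \<le> 2*m+1" for i
    using that jb by (auto simp: X_def)
  have mQ: "Q i \<in> X \<longleftrightarrow> Q i \<in> D \<or> i = j \<or> i = Suc (Suc b)" if "i \<le> 2*m" for i
    using that jb by (auto simp: X_def)
  have X: "P (Suc (Suc (Suc j))) \<notin> X" "P b \<notin> X" "Q (Suc (Suc j)) \<notin> X" "Q b \<notin> X"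
    using und und' ne par jb by (auto simp: X_def)
  have "Q (Suc j) \<in> X" "Q (Suc b) \<in> X" "P j \<in> X" "P (Suc (Suc (Suc b))) \<in> X"
      "Q j \<in> X" "Q (Suc (Suc b)) \<in> X"
      "P (Suc j) \<in> X" "P (Suc (Suc j)) \<in> X" "P (Suc b) \<in> X" "P (Suc (Suc b)) \<in> X"
    using I(3)[of "Suc j"] I(3)[of "Suc b"] \<open>even b\<close> \<open>even j\<close> jb und und' by (auto simp: X_def)
  note X = X this
  have "balanced X"
  proof (rule balancedI)
    show "inert X"
      unfolding inert_def
    proof (intro conjI[OF _ conjI[OF _ conjI]] allI impI)
      fix i assume i: "i \<le> 2*m"
      show "(P i \<in> X \<and> P (Suc i) \<in> X \<longrightarrow> Q i \<in> X) \<and> (P i \<in> X \<and> Q i \<in> X \<longrightarrow> P (Suc i) \<in> X)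
        \<and> (P (Suc i) \<in> X \<and> Q i \<in> X \<longrightarrow> P i \<in> X)"
      proof (cases "i \<in> {j, Suc j, Suc (Suc j), b, Suc b, Suc (Suc b)}")
        case True
        then show ?thesis using X by auto
      next
        case False
        then have eqs: "P i \<in> X \<longleftrightarrow> P i \<in> D" "P (Suc i) \<in> X \<longleftrightarrow> P (Suc i) \<in> D" "Q i \<in> X \<longleftrightarrow> Q i \<in> D"
          using i mP[of i] mP[of "Suc i"] mQ[of i] by simp_all
        show ?thesis unfolding eqs using I(4-6)[OF i] by blast
      qed
    qed (use I(1-3) in \<open>auto simp: X_def\<close>)
  next
    fix c d assume cd: "c + d = 2*m+1" "P c \<in> X"
    then have "P c \<in> D \<or> c = Suc j \<or> c = Suc (Suc j) \<or> c = Suc b \<or> c = Suc (Suc b)"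
      using mP[of c] by simp
    moreover have "c = Suc j \<Longrightarrow> d = Suc (Suc b)" "c = Suc (Suc j) \<Longrightarrow> d = Suc b"
      "c = Suc b \<Longrightarrow> d = Suc (Suc j)" "c = Suc (Suc b) \<Longrightarrow> d = Suc j"
      using cd(1) jb by auto
    ultimately show "P d \<in> X" using bal(4)[OF cd(1)] mP[of c] mP[of d] jb cd by auto
  next
    fix c d assume cd: "c + d = 2*m" "Q c \<in> X"
    then have "Q c \<in> D \<or> c = j \<or> c = Suc (Suc b)" using mQ[of c] by simp
    moreover have "c = j \<Longrightarrow> d = Suc (Suc b)" "c = Suc (Suc b) \<Longrightarrow> d = j" using cd(1) jb by auto
    ultimately show "Q d \<in> X" using bal(5)[OF cd(1)] mQ[of c] mQ[of d] jb cd by auto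
  qed (use bal(2,3) in \<open>auto simp: X_def\<close>)
  then show "balanced ?X" by (simp only: X_def)
qed

section \<open>Answers to the moves from a balanced position\<close>

text \<open>The edge \<open>e\<close> witnesses that fewer edges are undrawn in \<open>D'\<close>,
  and \<open>f\<close> that the game is not over there.\<close>

lemma losing_aboveD:
  assumes "losing_above D" "balanced D'" "D \<subseteq> D'"
    and "e \<in> edges (Suc m)" "e \<notin> D" "e \<in> D'" and "f \<in> edges (Suc m)" "f \<notin> D'"
  shows "net (Suc m) D' < 0"
proof -
  have "card (edges (Suc m) - D') < card (edges (Suc m) - D)"
    using assms by (intro psubset_card_mono) auto
  then show ?thesis using assms unfolding losing_above_def by blast
qed

lemma losing_above_mirror: "mirror.losing_above D \<longleftrightarrow> losing_above D"
  unfolding mirror.losing_above_def losing_above_def balanced_mirror ..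

text \<open>The answer is the mirror image \<open>Q l\<close>. It is a different edge, since
  \<open>Q m\<close> is already drawn.\<close>

lemma joint_move:
  assumes D: "balanced D" and la: "losing_above D" and k: "k \<le> 2*m"
    and und: "Q k \<notin> D" "P k \<notin> D" "P (Suc k) \<notin> D"
  shows "net (Suc m) (insert (Q k) D) > 0"
proof -
  define l where "l = 2*m - k"
  have kl: "k + l = 2*m" "l \<le> 2*m" using k by (auto simp: l_def)
  have "k \<noteq> m" using und balancedD(2)[OF D] by metis
  then have "k \<noteq> l" using kl by auto
  have ql: "Q l \<notin> D" "P (Suc l) \<notin> D"
    using und balancedD(4,5)[OF D, of k l] balancedD(4)[OF D, of k "Suc l"] kl by auto
  have "net (Suc m) (insert (Q l) (insert (Q k) D)) < 0"
    using und k kl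
    by (intro losing_aboveD[OF la balanced_joint[OF D kl(1) und], of "Q k" "P k"]) auto
  moreover have "net (Suc m) (insert (Q k) D) \<ge> - net (Suc m) (insert (Q l) (insert (Q k) D))"
    using ql kl \<open>k \<noteq> l\<close> k by (intro net_ge_quiet) (auto simp: completed_Q)
  ultimately show ?thesis by linarith
qed

text \<open>The opened triangle \<open>j+1\<close> is taken by \<open>P (Suc j)\<close> and its
  mirror image is sacrificed by \<open>P (Suc b)\<close>. The opponent can do no better than take
  it, by \<open>net_le_take_one\<close>; the two gains cancel and the opponent is to move in the
  balanced position \<open>X\<close>.\<close>

lemma single_chain_move:
  assumes D: "balanced D" and la: "losing_above D" and j: "even j" "Suc (Suc j) \<le> 2*m"
    and und: "P (Suc j) \<notin> D" "P (Suc (Suc j)) \<notin> D"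
      "Q j \<notin> D" "Q (Suc (Suc j)) \<notin> D" "P j \<notin> D" "P (Suc (Suc (Suc j))) \<notin> D"
  shows "net (Suc m) (insert (P (Suc (Suc j))) D) > 0"
proof -
  note bal = balancedD[OF D] and I = inertD[OF balancedD(1)[OF D]]
  define b where "b = 2*m - Suc (Suc j)"
  have jb: "Suc (Suc (j + b)) = 2*m" using j by (auto simp: b_def)
  define X where "X = D \<union> {P (Suc j), P (Suc (Suc j)), P (Suc b), P (Suc (Suc b))}"
  note X = balanced_single[OF D jb j(1) und]
  have und': "P (Suc b) \<notin> D" "P (Suc (Suc b)) \<notin> D"
      "P b \<notin> D" "P (Suc (Suc (Suc b))) \<notin> D" "Q b \<notin> D" "Q (Suc (Suc b)) \<notin> D"
    using und jb bal(4)[of j "Suc (Suc (Suc b))"] bal(4)[of "Suc (Suc (Suc j))" b]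
      bal(4)[of "Suc j" "Suc (Suc b)"] bal(4)[of "Suc (Suc j)" "Suc b"]
      bal(5)[of j "Suc (Suc b)"] bal(5)[of "Suc (Suc j)" b] by auto
  have "even b" using jb \<open>even j\<close> by presburger
  then have T: "Q (Suc j) \<in> D" "Q (Suc b) \<in> D" using I(3) j jb by auto
  have par: "j \<noteq> Suc b" "b \<noteq> Suc j" using \<open>even b\<close> \<open>even j\<close> by auto
  let ?D1 = "insert (P (Suc (Suc j))) D"
  let ?D2 = "insert (P (Suc j)) ?D1"
  let ?D3 = "insert (P (Suc b)) ?D2"
  have X': "insert (P (Suc (Suc b))) ?D3 = X" by (auto simp: X_def)
  have bX: "balanced X" unfolding X_def by (rule X(1))
  have "net (Suc m) X < 0"
    using und jb by (intro losing_aboveD[OF la bX, of "P (Suc j)" "Q j"]) (auto simp: X_def)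
  moreover have "net (Suc m) ?D1 \<ge> 1 + net (Suc m) ?D2"
    using und T jb by (intro net_ge_capture1) (auto simp: completed_P)
  moreover have "net (Suc m) ?D2 \<ge> - net (Suc m) ?D3"
    using und und' X(2-) par T jb by (intro net_ge_quiet) (auto simp: completed_P)
  moreover have "net (Suc m) ?D3 \<le> 1 + net (Suc m) X"
    unfolding X'[symmetric]
  proof (rule net_le_take_one)
    show "quiet (Suc m) (insert (P (Suc (Suc b))) ?D3)" unfolding X' by (rule inert_quiet[OF balancedD(1)[OF bX]])
  qed (use und und' X(2-) par T jb in \<open>auto simp: completed_P\<close>)
  ultimately show ?thesis by linarith
qed

text \<open>Whichever edge of the chain is drawn, the other two claim its two triangles. Then the
  mirrored chain is sacrificed, the gains of two cancel, and the opponent is to move in the balanced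
  position \<open>X\<close>.\<close>

lemma end_chain_move:
  assumes D: "balanced D" and la: "losing_above D" and j: "even j" "Suc (Suc j) \<le> 2*m"
    and und: "P (Suc j) \<notin> D" "P (Suc (Suc j)) \<notin> D"
      "Q j \<notin> D" "Q (Suc (Suc j)) \<notin> D" "P j \<in> D" "P (Suc (Suc (Suc j))) \<notin> D"
    and z: "z \<in> {Q j, P (Suc j), P (Suc (Suc j))}"
  shows "net (Suc m) (insert z D) > 0"
proof -
  note bal = balancedD[OF D] and I = inertD[OF balancedD(1)[OF D]]
  define b where "b = 2*m - Suc (Suc j)"
  have jb: "Suc (Suc (j + b)) = 2*m" using j by (auto simp: b_def)
  define X where "X = D \<union> {Q j, P (Suc j), P (Suc (Suc j)), P (Suc b), P (Suc (Suc b)), Q (Suc (Suc b))}"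
  note X = balanced_end[OF D jb j(1) und]
  have und': "P (Suc b) \<notin> D" "P (Suc (Suc b)) \<notin> D"
      "P b \<notin> D" "P (Suc (Suc (Suc b))) \<in> D" "Q b \<notin> D" "Q (Suc (Suc b)) \<notin> D"
    using und jb bal(4)[of j "Suc (Suc (Suc b))"] bal(4)[of "Suc (Suc (Suc j))" b]
      bal(4)[of "Suc j" "Suc (Suc b)"] bal(4)[of "Suc (Suc j)" "Suc b"]
      bal(5)[of j "Suc (Suc b)"] bal(5)[of "Suc (Suc j)" b] by auto
  have "even b" using jb \<open>even j\<close> by presburger
  then have T: "Q (Suc j) \<in> D" "Q (Suc b) \<in> D" using I(3) j jb by auto
  have par: "j \<noteq> Suc b" "b \<noteq> Suc j" using \<open>even b\<close> \<open>even j\<close> by auto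
  let ?R = "insert (Q j) (insert (P (Suc j)) (insert (P (Suc (Suc j))) D))"
  let ?R1 = "insert (P (Suc (Suc b))) ?R"
  have X': "insert (P (Suc b)) (insert (Q (Suc (Suc b))) ?R1) = X" by (auto simp: X_def)
  have bX: "balanced X" unfolding X_def by (rule X(1))
  have "net (Suc m) X < 0"
    using und jb X(2-) by (intro losing_aboveD[OF la bX, of "P (Suc j)" "Q (Suc (Suc j))"]) (auto simp: X_def)
  moreover have "net (Suc m) (insert z D) \<ge> 2 + net (Suc m) ?R"
  proof -
    have take: "net (Suc m) (insert z D) \<ge> 2 + net (Suc m) (insert y (insert x (insert z D)))"
      if "x \<in> edges (Suc m) - insert z D" "completed (Suc m) (insert z D) x > 0"
        "y \<in> edges (Suc m) - insert x (insert z D)" "completed (Suc m) (insert x (insert z D)) y > 0" for x y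
      using net_ge_capture1[OF that(1,2)] net_ge_capture1[OF that(3,4)] by linarith
    from z consider "z = Q j" | "z = P (Suc j)" | "z = P (Suc (Suc j))" by blast
    then show ?thesis
    proof cases
      case 1
      have "insert (P (Suc (Suc j))) (insert (P (Suc j)) (insert z D)) = ?R" using 1 by auto
      then show ?thesis using take[of "P (Suc j)" "P (Suc (Suc j))"] 1 und T jb
        by (simp add: completed_P)
    next
      case 2
      have "insert (P (Suc (Suc j))) (insert (Q j) (insert z D)) = ?R" using 2 by auto
      then show ?thesis using take[of "Q j" "P (Suc (Suc j))"] 2 und T jb
        by (simp add: completed_P completed_Q)
    next
      case 3
      have "insert (Q j) (insert (P (Suc j)) (insert z D)) = ?R" using 3 by auto
      then show ?thesis using take[of "P (Suc j)" "Q j"] 3 und T jb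
        by (simp add: completed_P completed_Q)
    qed
  qed
  \<comment> \<open>The sacrifice is the edge shared by the two triangles. Each of them can then
    only be taken separately, so the opponent cannot hand back both with a single edge.\<close>
  moreover have "net (Suc m) ?R \<ge> - net (Suc m) ?R1"
    using und und' X(2-) par T jb by (intro net_ge_quiet) (auto simp: completed_P)
  moreover have "net (Suc m) ?R1 \<le> 2 + net (Suc m) X"
    unfolding X'[symmetric]
  proof (rule net_le_take_two)
    show "quiet (Suc m) (insert (P (Suc b)) (insert (Q (Suc (Suc b))) ?R1))"
      unfolding X' by (rule inert_quiet[OF balancedD(1)[OF bX]])
  qed (use und und' X(2-) par T jb in \<open>auto simp: completed_P completed_Q\<close>)
  ultimately show ?thesis by linarith
qed

text \<open>If triangle \<open>k+2\<close> is a joint, the chain has exactly the triangles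
  \<open>k\<close> and \<open>k+1\<close>. Otherwise it has at least three: one is taken, and
  \<open>run_right\<close> for the next two leaves a margin of at least one.\<close>

lemma end_move:
  assumes D: "balanced D" and la: "losing_above D" and k: "even k" "k \<le> 2*m"
    and und: "Q k \<notin> D" "P k \<in> D" "P (Suc k) \<notin> D"
  shows "net (Suc m) (insert (Q k) D) > 0"
proof -
  note I = inertD[OF balancedD(1)[OF D]]
  have "k \<noteq> 2*m" using und I(2) by auto
  with k have k2: "Suc (Suc k) \<le> 2*m" by presburger
  have T: "Q (Suc k) \<in> D" using I(3) k k2 by auto
  have P2: "P (Suc (Suc k)) \<notin> D" using I(6)[of "Suc k"] T und k2 by auto
  show ?thesis
  proof (cases "Q (Suc (Suc k)) \<in> D \<longleftrightarrow> P (Suc (Suc (Suc k))) \<in> D")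
    case True
    with I(5)[of "Suc (Suc k)"] I(6)[of "Suc (Suc k)"] P2 k2
    have "Q (Suc (Suc k)) \<notin> D" "P (Suc (Suc (Suc k))) \<notin> D" by auto
    then show ?thesis using end_chain_move[OF D la k(1) k2] und P2 by auto
  next
    case False
    let ?D1 = "insert (Q k) D"
    let ?D2 = "insert (P (Suc k)) ?D1"
    have "net (Suc m) ?D1 \<ge> 1 + net (Suc m) ?D2"
      using und k2 by (intro net_ge_capture1) (auto simp: completed_P)
    moreover have "net (Suc m) ?D2 \<ge> 0"
    proof (rule run_right[of "Suc k"])
      assume "P (Suc (Suc (Suc k))) \<notin> ?D2"
      then have P3: "P (Suc (Suc (Suc k))) \<notin> D" by simp
      have "Suc (Suc k) \<noteq> 2*m" using I(2) P3 by auto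
      with k2 have k3: "Suc (Suc (Suc k)) \<le> 2*m" by simp
      with k have k4: "Suc (Suc (Suc (Suc k))) \<le> 2*m" by presburger
      \<comment> \<open>Triangle \<open>k+3\<close> is odd, so its two path sides are undrawn
        together; this gives the hypothesis \<open>far\<close> of \<open>run_right\<close>.\<close>
      have "Q (Suc (Suc (Suc k))) \<in> D" using I(3) k k3 by auto
      with P3 I(6)[OF k3] have "P (Suc (Suc (Suc (Suc k)))) \<notin> D" by auto
      then show "\<not> (P (Suc (Suc (Suc (Suc k)))) \<in> ?D2 \<and> Q (Suc (Suc (Suc k))) \<in> ?D2)"
        using k4 by auto
    qed (use und k2 T P2 I(2) False in auto)
    ultimately show ?thesis by linarith
  qed
qed

text \<open>The odd triangle \<open>j+1\<close> lies on a chain, and the cases record how triangles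
  \<open>j\<close> and \<open>j+2\<close> continue it. In the first three the chain has at least
  three triangles, and a capture followed by a run of two wins. In the next two it has two
  triangles, stopping on the left or on the right, and in the last one \<open>j+1\<close> is alone
  between two joints.\<close>

lemma path_move:
  assumes D: "balanced D" and la: "losing_above D" and j: "even j" "Suc (Suc j) \<le> 2*m"
    and und: "P (Suc j) \<notin> D" "P (Suc (Suc j)) \<notin> D"
  shows "net (Suc m) (insert (P (Suc (Suc j))) D) > 0"
proof -
  note I = inertD[OF balancedD(1)[OF D]]
  let ?D1 = "insert (P (Suc (Suc j))) D"
  let ?D2 = "insert (P (Suc j)) ?D1"
  have T: "Q (Suc j) \<in> D" using I(3) j by auto
  have take: "net (Suc m) ?D1 \<ge> 1 + net (Suc m) ?D2"
    using und j T by (intro net_ge_capture1) (auto simp: completed_P)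
  have notboth: "\<not> (P j \<in> D \<and> Q j \<in> D)" "\<not> (P (Suc (Suc (Suc j))) \<in> D \<and> Q (Suc (Suc j)) \<in> D)"
    using I(5)[of j] I(6)[of "Suc (Suc j)"] und j by auto
  consider "P j \<notin> D" "Q j \<in> D"
    | "P (Suc (Suc (Suc j))) \<notin> D" "Q (Suc (Suc j)) \<in> D"
    | "Q j \<notin> D" "Q (Suc (Suc j)) \<notin> D" "P j \<in> D" "P (Suc (Suc (Suc j))) \<in> D"
    | "Q j \<notin> D" "Q (Suc (Suc j)) \<notin> D" "P j \<in> D" "P (Suc (Suc (Suc j))) \<notin> D"
    | "Q j \<notin> D" "Q (Suc (Suc j)) \<notin> D" "P j \<notin> D" "P (Suc (Suc (Suc j))) \<in> D"
    | "Q j \<notin> D" "Q (Suc (Suc j)) \<notin> D" "P j \<notin> D" "P (Suc (Suc (Suc j))) \<notin> D"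
    using notboth by blast
  then show ?thesis
  proof cases
    case 1
    then have "j \<noteq> 0" using I(1) by metis
    then have "\<exists>i. j = Suc (Suc i) \<and> even i" using j(1) by presburger
    then obtain i where i: "j = Suc (Suc i)" "even i" by blast
    have Qi: "Q (Suc i) \<in> D" using I(3) i j by auto
    with 1 I(5)[of "Suc i"] i j have Pi: "P (Suc i) \<notin> D" by auto
    with I(5)[of i] i j have "\<not> (P i \<in> D \<and> Q i \<in> D)" by auto
    then have "net (Suc m) ?D2 \<ge> 0"
      using 1 i j Qi Pi I(1) und by (intro run_left[of "Suc i"]) auto
    with take show ?thesis by linarith
  next
    case 2
    have "Suc (Suc j) \<noteq> 2*m" using I(2) 2 by auto
    with j have j4: "Suc (Suc (Suc (Suc j))) \<le> 2*m" by presburger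
    have Q3: "Q (Suc (Suc (Suc j))) \<in> D" using I(3) j j4 by auto
    with 2 I(6)[of "Suc (Suc (Suc j))"] j4 have P4: "P (Suc (Suc (Suc (Suc j)))) \<notin> D" by auto
    with I(6)[of "Suc (Suc (Suc (Suc j)))"] j4
    have "\<not> (P (Suc (Suc (Suc (Suc (Suc j))))) \<in> D \<and> Q (Suc (Suc (Suc (Suc j)))) \<in> D)" by auto
    then have "net (Suc m) ?D2 \<ge> 0"
      using 2 j4 Q3 P4 I(2) und by (intro run_right[of "Suc (Suc j)"]) auto
    with take show ?thesis by linarith
  next
    case 3
    \<comment> \<open>The chain is exactly \<open>j\<close>, \<open>j+1\<close>, \<open>j+2\<close>.
      Taking the middle triangle would split the rest into two separate captures, so the outer
      triangle \<open>j+2\<close> is taken first, which leaves a run of two.\<close>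
    let ?D3 = "insert (Q (Suc (Suc j))) ?D1"
    have "net (Suc m) ?D1 \<ge> 1 + net (Suc m) ?D3"
      using 3 j by (intro net_ge_capture1) (auto simp: completed_Q)
    moreover have "net (Suc m) ?D3 \<ge> 0"
      using 3 j T I(1) und by (intro run_left[of j]) auto
    ultimately show ?thesis by linarith
  next
    case 4
    then show ?thesis using end_chain_move[OF D la j und] by auto
  next
    case 5
    \<comment> \<open>The reflection of the previous case: triangle \<open>j+2\<close> is triangle
      \<open>b\<close> of the reversed strip.\<close>
    define b where "b = 2*m - Suc (Suc j)"
    have eqs: "2*m+1-Suc b = Suc (Suc j)" "2*m+1-Suc (Suc b) = Suc j" "2*m-b = Suc (Suc j)"
      "2*m-Suc (Suc b) = j" "2*m+1-b = Suc (Suc (Suc j))" "2*m+1-Suc (Suc (Suc b)) = j"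
      using j by (auto simp: b_def)
    have "even b" "Suc (Suc b) \<le> 2*m" using j by (auto simp: b_def)
    then show ?thesis
      using strip.end_chain_move[OF mirror_strip, of D b "P (Suc (Suc j))",
          unfolded eqs balanced_mirror losing_above_mirror] D la und 5 by auto
  next
    case 6
    then show ?thesis using single_chain_move[OF D la j und] by auto
  qed
qed

section \<open>Balanced positions are lost for the player to move\<close>

lemma balanced_losing:
  assumes "balanced D" "edges (Suc m) - D \<noteq> {}"
  shows "net (Suc m) D < 0"
  using assms
proof (induction "card (edges (Suc m) - D)" arbitrary: D rule: less_induct)
  case less
  note D = less.prems(1)
  note I = inertD[OF balancedD(1)[OF D]]
  have la: "losing_above D"
    using less.hyps unfolding losing_above_def by blast
  have z: "net (Suc m) (insert z D) > 0" if z: "z \<in> edges (Suc m) - D" for z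
    using I(1,2) z
  proof (cases rule: P_undrawn_cases)
    case (1 k)
    show ?thesis
    \<comment> \<open>Exactly one of the triangles \<open>k\<close> and \<open>Suc k\<close> is odd.
      For odd \<open>k\<close> the edge is the right side of triangle \<open>k\<close>, as in
      \<open>path_move\<close>; for even \<open>k\<close> it is the left side of triangle
      \<open>Suc k\<close>, and the reflected lemma applies.\<close>
    proof (cases "even k")
      case True
      define b where "b = 2*m - Suc (Suc k)"
      have k2: "Suc (Suc k) \<le> 2*m" using 1 True by presburger
      then have P2: "P (Suc (Suc k)) \<notin> D" using 1 I(3)[of "Suc k"] I(6)[of "Suc k"] True by auto
      have eqs: "2*m+1-Suc b = Suc (Suc k)" "2*m+1-Suc (Suc b) = Suc k"
        using k2 by (auto simp: b_def)
      have "even b" "Suc (Suc b) \<le> 2*m" using k2 True by (auto simp: b_def)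
      then show ?thesis
        using strip.path_move[OF mirror_strip, of D b,
            unfolded eqs balanced_mirror losing_above_mirror] D la 1 P2 by auto
    next
      case False
      then obtain j where j: "k = Suc j" "even j" by (metis even_Suc not0_implies_Suc even_zero)
      with 1 I(3)[of k] I(5)[of k] have "P (Suc j) \<notin> D" by auto
      then show ?thesis using path_move[OF D la j(2)] 1 j by auto
    qed
  next
    case (2 k)
    have "even k" using I(3) 2 by blast
    consider "P k \<notin> D" "P (Suc k) \<notin> D" | "P k \<in> D" "P (Suc k) \<notin> D" | "P k \<notin> D" "P (Suc k) \<in> D"
      using I(4)[of k] 2 by blast
    then show ?thesis
    proof cases
      case 1
      then show ?thesis using joint_move[OF D la 2(1)] 2 by auto
    next
      case 2
      then show ?thesis using end_move[OF D la \<open>even k\<close>] \<open>k \<le> 2*m\<close> \<open>z = Q k\<close> \<open>Q k \<notin> D\<close> by auto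
    next
      case 3
      define b where "b = 2*m - k"
      have eqs: "2*m-b = k" "2*m+1-b = Suc k" "2*m+1-Suc b = k" using 2 by (auto simp: b_def)
      have "even b" "b \<le> 2*m" using \<open>even k\<close> by (auto simp: b_def)
      then show ?thesis
        using strip.end_move[OF mirror_strip, of D b,
            unfolded eqs balanced_mirror losing_above_mirror] D la 2 3 by auto
    qed
  qed
  from less.prems(2) show ?case
  proof (cases rule: net_cases)
    case (1 e)
    then show ?thesis using inert_quiet[OF balancedD(1)[OF D]] by (auto simp: quiet_def)
  next
    case (2 e)
    then show ?thesis using z[of e] by auto
  qed
qed

section \<open>The opening move\<close>

text \<open>For \<open>m = 0\<close> the only triangle is taken at once. Otherwise the opening leads
  to a balanced position: the condition on the centre holds through the top edge
  \<open>Q (m-1)\<close> if \<open>m\<close> is even and through \<open>P m\<close> if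
  \<open>m\<close> is odd.\<close>

lemma net_closed_pos:
  assumes P: "\<And>i. i \<le> 2*m+1 \<Longrightarrow> P i \<in> D \<longleftrightarrow> i = 0 \<or> i = 2*m+1"
    and Q: "\<And>i. i \<le> 2*m \<Longrightarrow> Q i \<in> D \<longleftrightarrow> odd i" and "m \<noteq> 1"
  shows "net (Suc m) D > 0"
proof -
  consider "m = 0" | "even m" "m > 0" | "odd m" by blast
  then show ?thesis
  proof cases
    case 1
    then have "completed (Suc m) D (Q 0) > 0" using P[of 0] P[of 1] completed_Q[of 0 D] by simp
    then have "net (Suc m) D \<ge> 1 + net (Suc m) (insert (Q 0) D)"
      using Q[of 0] by (intro net_ge_capture1) auto
    moreover have "{..2*m+1} = {0, 1}" "{..2*m} = {0}"
      using 1 by auto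
    then have "edges (Suc m) - insert (Q 0) D = {}"
      unfolding edges_eq using P[of 0] P[of 1] 1 by auto
    ultimately show ?thesis by (simp add: net_finished)
  next
    case 2
    define X where "X = insert (Q m) D"
    have PX: "P i \<in> X \<longleftrightarrow> i = 0 \<or> i = 2*m+1" if "i \<le> 2*m+1" for i
      using that P[OF that] by (auto simp: X_def)
    have QX: "Q i \<in> X \<longleftrightarrow> odd i \<or> i = m" if "i \<le> 2*m" for i
      using that Q[OF that] by (auto simp: X_def)
    have "inert X"
      unfolding inert_def
    proof (intro conjI[OF _ conjI[OF _ conjI]] allI impI)
      fix i assume i: "i \<le> 2*m"
      then have eqs: "P i \<in> X \<longleftrightarrow> i = 0" "P (Suc i) \<in> X \<longleftrightarrow> i = 2*m"
        using PX[of i] PX[of "Suc i"] by auto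
      show "(P i \<in> X \<and> P (Suc i) \<in> X \<longrightarrow> Q i \<in> X) \<and> (P i \<in> X \<and> Q i \<in> X \<longrightarrow> P (Suc i) \<in> X)
        \<and> (P (Suc i) \<in> X \<and> Q i \<in> X \<longrightarrow> P i \<in> X)"
        unfolding eqs QX[OF i] using i 2 by presburger
    qed (simp_all add: PX QX)
    then have "balanced X"
    proof (rule balancedI)
      fix c d assume cd: "c + d = 2*m+1" "P c \<in> X"
      then show "P d \<in> X" using PX[of c] PX[of d] by auto
    next
      fix c d assume cd: "c + d = 2*m" "Q c \<in> X"
      then have "odd c \<or> c = m" using QX[of c] by auto
      then have "odd d \<or> d = m" using cd(1) by presburger
      then show "Q d \<in> X" using QX[of d] cd(1) by auto
    qed (use 2 in \<open>auto simp: PX QX\<close>)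
    moreover have "P 1 \<in> edges (Suc m) - X" using 2 PX[of 1] by simp
    ultimately have "net (Suc m) X < 0" using balanced_losing by blast
    moreover have "net (Suc m) D \<ge> - net (Suc m) X"
      unfolding X_def using 2 P[of m] Q[of m] by (intro net_ge_quiet) (auto simp: completed_Q)
    ultimately show ?thesis by linarith
  next
    case 3
    then have "m \<noteq> 0" by (metis even_zero)
    \<comment> \<open>For \<open>m = 1\<close> the neighbours of the central triangle are the end
      triangles, whose outer sides are drawn, and the sacrifice would make them claimable.\<close>
    with \<open>m \<noteq> 1\<close> have m: "m > 1" by simp
    define D1 where "D1 = insert (P m) D"
    define X where "X = insert (P (Suc m)) D1"
    have PX: "P i \<in> X \<longleftrightarrow> i = 0 \<or> i = 2*m+1 \<or> i = m \<or> i = Suc m" if "i \<le> 2*m+1" for i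
      using that P[OF that] by (auto simp: X_def D1_def)
    have QX: "Q i \<in> X \<longleftrightarrow> odd i" if "i \<le> 2*m" for i
      using that Q[OF that] by (auto simp: X_def D1_def)
    have "inert X"
      unfolding inert_def
    proof (intro conjI[OF _ conjI[OF _ conjI]] allI impI)
      fix i assume i: "i \<le> 2*m"
      then have eqs: "P i \<in> X \<longleftrightarrow> i = 0 \<or> i = m \<or> i = Suc m" "P (Suc i) \<in> X \<longleftrightarrow> i = 2*m \<or> Suc i = m \<or> i = m"
        using PX[of i] PX[of "Suc i"] by auto
      show "(P i \<in> X \<and> P (Suc i) \<in> X \<longrightarrow> Q i \<in> X) \<and> (P i \<in> X \<and> Q i \<in> X \<longrightarrow> P (Suc i) \<in> X)
        \<and> (P (Suc i) \<in> X \<and> Q i \<in> X \<longrightarrow> P i \<in> X)"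
        unfolding eqs QX[OF i] using i 3 m by presburger
    qed (simp_all add: PX QX)
    then have bX: "balanced X"
    proof (rule balancedI)
      fix c d assume cd: "c + d = 2*m+1" "P c \<in> X"
      then show "P d \<in> X" using PX[of c] PX[of d] by auto
    next
      fix c d assume cd: "c + d = 2*m" "Q c \<in> X"
      then have "odd c" using QX[of c] by auto
      then have "odd d" using cd(1) by presburger
      then show "Q d \<in> X" using QX[of d] cd(1) by auto
    qed (use 3 m in \<open>auto simp: PX QX\<close>)
    have "Q 0 \<in> edges (Suc m) - X" using QX[of 0] by simp
    with bX have "net (Suc m) X < 0" using balanced_losing by blast
    moreover have "net (Suc m) D \<ge> - net (Suc m) D1"
      unfolding D1_def
    proof (rule net_ge_quiet)
      show "P m \<in> edges (Suc m) - D" using P[of m] m by auto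
      show "completed (Suc m) D (P m) = 0"
        using P[of "m-1"] P[of "Suc m"] completed_P[of "m-1" D] m by simp
    qed
    moreover have "net (Suc m) D1 \<le> 1 + net (Suc m) X"
      unfolding X_def
    proof (rule net_le_take_one)
      show "quiet (Suc m) (insert (P (Suc m)) D1)"
        using inert_quiet[OF \<open>inert X\<close>] by (simp add: X_def)
      show "P (Suc m) \<in> edges (Suc m) - D1" using P[of "Suc m"] m by (auto simp: D1_def)
      show "completed (Suc m) D1 (P (Suc m)) = 1"
        using P[of "Suc (Suc m)"] Q[of m] m 3 by (simp add: completed_P D1_def)
    qed
    \<comment> \<open>The bounds so far give only \<open>net (Suc m) D \<ge> 0\<close>: the
      sacrifice costs one triangle and \<open>net (Suc m) X \<le> -1\<close>. All
      \<open>2*m+1\<close> triangles are still incomplete in \<open>D\<close>, so the value is odd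
      and hence positive.\<close>
    moreover have "{T \<in> triangles (Suc m). \<not> T \<subseteq> D} = coin ` {..2*m}"
    proof -
      have "\<not> coin i \<subseteq> D" if "i \<le> 2*m" for i
        using that P[of i] P[of "Suc i"] Q[of i] m by (auto simp: coin_def)
      then show ?thesis by (auto simp: triangles_eq coin_def)
    qed
    then have "odd (card {T \<in> triangles (Suc m). \<not> T \<subseteq> D})"
      by (simp add: card_image inj_coin)
    then have "odd (net (Suc m) D)" using net_parity[of "Suc m" D] by simp
    then have "net (Suc m) D \<noteq> 0" by (metis even_zero)
    ultimately show ?thesis by linarith
  qed
qed

end

section \<open>The board as a strip\<close>

text \<open>The zigzag from \<open>b_0\<close> through \<open>t_1\<close>, \<open>b_1\<close>,
  \<open>t_2\<close> and so on to \<open>b_n\<close>, counted from 0.\<close>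

definition path_edge :: "nat \<Rightarrow> edge" where
  "path_edge k = (if even k then Lft (Suc (k div 2)) else Rgt (Suc (k div 2)))"

text \<open>Even triangles stand on the bottom line and odd ones hang from the top line, so the
  edges already drawn at the top are the odd ones.\<close>

definition side_edge :: "nat \<Rightarrow> edge" where
  "side_edge k = (if even k then Bot (Suc (k div 2)) else Top (Suc (k div 2)))"

lemma path_edge_simps [simp]:
  "path_edge (2*i) = Lft (Suc i)" "path_edge (Suc (2*i)) = Rgt (Suc i)"
  by (simp_all add: path_edge_def)

lemma side_edge_simps [simp]:
  "side_edge (2*i) = Bot (Suc i)" "side_edge (Suc (2*i)) = Top (Suc i)"
  by (simp_all add: side_edge_def)

lemma half_eqD: "i div 2 = j div 2 \<Longrightarrow> even i \<longleftrightarrow> even j \<Longrightarrow> i = j" for i j :: nat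
  by presburger

lemma path_edge_inj: "path_edge i = path_edge j \<longleftrightarrow> i = j"
  unfolding path_edge_def by (auto split: if_splits intro: half_eqD)

lemma side_edge_inj: "side_edge i = side_edge j \<longleftrightarrow> i = j"
  unfolding side_edge_def by (auto split: if_splits intro: half_eqD)

lemma strip_board: "strip m path_edge side_edge"
proof
  show "edges (Suc m) = path_edge ` {..2*m+1} \<union> side_edge ` {..2*m}" (is "?L = ?R")
  proof
    show "?L \<subseteq> ?R"
    proof
      fix e assume "e \<in> ?L"
      then consider i where "e = Bot (Suc i)" "i \<le> m" | i where "e = Top (Suc i)" "i < m"
        | i where "e = Lft (Suc i)" "i \<le> m" | i where "e = Rgt (Suc i)" "i \<le> m"
        unfolding edges_def by (auto simp: Suc_le_eq gr0_conv_Suc less_Suc_eq_le)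
      then show "e \<in> ?R"
      proof cases
        case (1 i)
        then show ?thesis by (intro UnI2 image_eqI[of _ _ "2*i"]) auto
      next
        case (2 i)
        then show ?thesis by (intro UnI2 image_eqI[of _ _ "Suc (2*i)"]) auto
      next
        case (3 i)
        then show ?thesis by (intro UnI1 image_eqI[of _ _ "2*i"]) auto
      next
        case (4 i)
        then show ?thesis by (intro UnI1 image_eqI[of _ _ "Suc (2*i)"]) auto
      qed
    qed
    show "?R \<subseteq> ?L"
      unfolding edges_def path_edge_def side_edge_def by (auto elim!: evenE oddE)
  qed
  show "triangles (Suc m) = (\<lambda>k. {path_edge k, path_edge (Suc k), side_edge k}) ` {..2*m}"
    (is "?L = ?f ` _")
  proof -
    have f: "?f (2*i) = {Bot (Suc i), Lft (Suc i), Rgt (Suc i)}"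
      "?f (Suc (2*i)) = {Top (Suc i), Rgt (Suc i), Lft (Suc (Suc i))}" for i
      using path_edge_simps(1)[of "Suc i"] by auto
    show ?thesis
    proof
      show "?L \<subseteq> ?f ` {..2*m}"
      proof
        fix T assume "T \<in> ?L"
        then consider i where "T = {Bot (Suc i), Lft (Suc i), Rgt (Suc i)}" "i \<le> m"
          | i where "T = {Top (Suc i), Rgt (Suc i), Lft (Suc (Suc i))}" "i < m"
          unfolding triangles_def by (auto simp: Suc_le_eq gr0_conv_Suc less_Suc_eq_le)
        then show "T \<in> ?f ` {..2*m}"
        proof cases
          case (1 i)
          then show ?thesis by (intro image_eqI[of _ _ "2*i"]) (simp_all only: f, simp)
        next
          case (2 i)
          then show ?thesis by (intro image_eqI[of _ _ "Suc (2*i)"]) (simp_all only: f, simp)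
        qed
      qed
      show "?f ` {..2*m} \<subseteq> ?L"
      proof
        fix T assume "T \<in> ?f ` {..2*m}"
        then obtain k where k: "k \<le> 2*m" "T = ?f k" by auto
        obtain i where "k = 2*i \<or> k = Suc (2*i)" by (metis evenE oddE Suc_eq_plus1)
        then show "T \<in> ?L"
        proof
          assume "k = 2*i"
          with k show ?thesis unfolding triangles_def using f(1)[of i] by auto
        next
          assume "k = Suc (2*i)"
          with k show ?thesis unfolding triangles_def using f(2)[of i] by auto
        qed
      qed
    qed
  qed
qed (auto simp: path_edge_inj side_edge_inj, simp add: path_edge_def side_edge_def split: if_splits)

theorem theorem1:
  fixes n :: nat
  assumes "n \<ge> 1" and "n \<noteq> 2"
  shows "first_wins n (init_drawn n) 0 0 True"
proof -
  obtain m where m: "n = Suc m" "m \<noteq> 1" using assms by (cases n) auto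
  have "path_edge i \<in> init_drawn (Suc m) \<longleftrightarrow> i = 0 \<or> i = 2*m+1" if "i \<le> 2*m+1" for i
    by (auto simp: init_drawn_def path_edge_def elim!: evenE oddE) presburger
  moreover have "side_edge i \<in> init_drawn (Suc m) \<longleftrightarrow> odd i" if "i \<le> 2*m" for i
    using that by (auto simp: init_drawn_def side_edge_def elim!: evenE oddE)
  ultimately have "net (Suc m) (init_drawn (Suc m)) > 0"
    using strip.net_closed_pos[OF strip_board] m(2) by blast
  then show ?thesis using m by (intro first_wins_if_net_pos) simp
qed

end
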